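(* Let $\Gamma$ be a finite group with identity $e$ and right regular representation matrices $\{R_g\}_{g\in\Gamma}$, let $\eta:\Gamma\to\mathbb Z_2$, and let $G=\sum_{g\in\Gamma}\eta(g)R_g$. Then $G$ is the Gramian of a binary Parseval $\Gamma$-frame if and only if $\eta(e)=1$, $\eta$ is symmetric under inversion of its argument (i.e. $\eta(g)=\eta(g^{-1})$ for all $g\in\Gamma$), and $\eta$ is idempotent under convolution (i.e. $\eta=\eta*\eta$).
   Context: All vectors and matrices are over the field $\mathbb Z_2$ with two elements. The convolution is $(\eta*\eta)(h)=\sum_{g\in\Gamma}\eta(g)\eta(g^{-1}h)$. The dot product on $\mathbb Z_2^n$ is $\langle a,b\rangle=\sum_{i=1}^n a_ib_i\in\mathbb Z_2$. A finite family $\{f_j\}_{j\in J}$ in $\mathbb Z_2^n$ is a binary Parseval frame if $x=\sum_{j\in J}\langle x,f_j\rangle f_j$ for all $x\in\mathbb Z_2^n$. A family $\{f_g\}_{g\in\Gamma}$ in $\mathbb Z_2^n$ (for some $n$) is a binary Parseval $\Gamma$-frame if it is a binary Parseval frame and there is a representation (group homomorphism) $\rho:\Gamma\to \mathrm{GL}(\mathbb Z_2^n)$ with $f_g=\rho(g)f_e$ for all $g\in\Gamma$. The Gramian of $\{f_g\}_{g\in\Gamma}$ is the linear map on $\mathbb Z_2^\Gamma$ with matrix entries $G_{a,b}=\langle f_b,f_a\rangle$ in the standard basis. The right regular representation acts on functions $\varphi:\Gamma\to\mathbb Z_2$ by $(R_g\varphi)(h)=\varphi(hg)$. *)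

theory Defs
  imports "HOL-Library.Z2" "HOL-Library.FuncSet" "Jordan_Normal_Form.Matrix"
begin

text \<open>The field with two elements is \<^typ>\<open>bit\<close>; the space of column vectors of length n over it
  is \<^term>\<open>carrier_vec n :: bit vec set\<close>, with dot product \<open>\<bullet>\<close>.\<close>

definition general_linear :: "nat \<Rightarrow> bit mat monoid" where
  "general_linear n = units_of (ring_mat TYPE(bit) n ())"

definition binary_parseval_frame :: "nat \<Rightarrow> 'j set \<Rightarrow> ('j \<Rightarrow> bit vec) \<Rightarrow> bool" where
  "binary_parseval_frame n J f \<longleftrightarrow>
     finite J \<and> f \<in> J \<rightarrow> carrier_vec n \<and>
     (\<forall>x\<in>carrier_vec n. x = finsum_vec TYPE(bit) n (\<lambda>j. (x \<bullet> f j) \<cdot>\<^sub>v f j) J)"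

definition binary_parseval_group_frame ::
    "('a, 'm) monoid_scheme \<Rightarrow> nat \<Rightarrow> ('a \<Rightarrow> bit vec) \<Rightarrow> bool" where
  "binary_parseval_group_frame \<Gamma> n f \<longleftrightarrow>
     binary_parseval_frame n (carrier \<Gamma>) f \<and>
     (\<exists>\<rho>\<in>hom \<Gamma> (general_linear n). \<forall>g\<in>carrier \<Gamma>. f g = \<rho> g *\<^sub>v f \<one>\<^bsub>\<Gamma>\<^esub>)"

text \<open>A function on the group is represented by its extensional extension (arbitrary but fixed
  value outside the carrier), and an operator on such functions is likewise extensional on
  \<open>bit_functions\<close>, so that equality of operators is equality as maps of this space.\<close>

definition bit_functions :: "('a, 'm) monoid_scheme \<Rightarrow> ('a \<Rightarrow> bit) set" where
  "bit_functions \<Gamma> = (carrier \<Gamma> \<rightarrow>\<^sub>E UNIV)"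

definition right_regular ::
    "('a, 'm) monoid_scheme \<Rightarrow> 'a \<Rightarrow> ('a \<Rightarrow> bit) \<Rightarrow> ('a \<Rightarrow> bit)" where
  "right_regular \<Gamma> g = (\<lambda>\<phi>\<in>bit_functions \<Gamma>. \<lambda>h\<in>carrier \<Gamma>. \<phi> (h \<otimes>\<^bsub>\<Gamma>\<^esub> g))"

definition right_regular_sum ::
    "('a, 'm) monoid_scheme \<Rightarrow> ('a \<Rightarrow> bit) \<Rightarrow> ('a \<Rightarrow> bit) \<Rightarrow> ('a \<Rightarrow> bit)" where
  "right_regular_sum \<Gamma> \<eta> =
     (\<lambda>\<phi>\<in>bit_functions \<Gamma>. \<lambda>h\<in>carrier \<Gamma>. \<Sum>g\<in>carrier \<Gamma>. \<eta> g * right_regular \<Gamma> g \<phi> h)"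

text \<open>The operator whose matrix entry in row a and column b is \<open>f b \<bullet> f a\<close>.\<close>

definition gramian ::
    "('a, 'm) monoid_scheme \<Rightarrow> ('a \<Rightarrow> bit vec) \<Rightarrow> ('a \<Rightarrow> bit) \<Rightarrow> ('a \<Rightarrow> bit)" where
  "gramian \<Gamma> f =
     (\<lambda>\<phi>\<in>bit_functions \<Gamma>. \<lambda>a\<in>carrier \<Gamma>. \<Sum>b\<in>carrier \<Gamma>. (f b \<bullet> f a) * \<phi> b)"

text \<open>The dimension n is positive: in dimension 0 the zero family would be a Parseval frame with
  Gramian 0.\<close>

definition is_gramian_of_binary_parseval_group_frame ::
    "('a, 'm) monoid_scheme \<Rightarrow> (('a \<Rightarrow> bit) \<Rightarrow> ('a \<Rightarrow> bit)) \<Rightarrow> bool" where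
  "is_gramian_of_binary_parseval_group_frame \<Gamma> G \<longleftrightarrow>
     (\<exists>n f. 0 < n \<and> binary_parseval_group_frame \<Gamma> n f \<and> G = gramian \<Gamma> f)"

definition convolution ::
    "('a, 'm) monoid_scheme \<Rightarrow> ('a \<Rightarrow> bit) \<Rightarrow> ('a \<Rightarrow> bit) \<Rightarrow> ('a \<Rightarrow> bit)" where
  "convolution \<Gamma> \<eta> \<theta> h = (\<Sum>g\<in>carrier \<Gamma>. \<eta> g * \<theta> (inv\<^bsub>\<Gamma>\<^esub> g \<otimes>\<^bsub>\<Gamma>\<^esub> h))"

end

theory Submission
  imports Defs "HOL-Library.Function_Algebras"
begin

text \<open>The operator \<open>G\<close> has matrix entries \<open>\<eta> (a\<^sup>-\<^sup>1 b)\<close>, so symmetry and idempotence of \<open>\<eta>\<close> say that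
  \<open>G\<close> is symmetric and idempotent, as every Gramian of a Parseval frame is. All diagonal entries
  of \<open>G\<close> are \<open>\<eta> e\<close>. Since \<open>\<langle>x, x\<rangle>\<close> is linear in \<open>x\<close> over the field with two elements, the diagonal
  of a Gramian cannot vanish, as the frame spans a nonzero space. Conversely, a symmetric
  bilinear form over this field that is not alternating has an orthonormal basis modulo its
  radical; the coordinates of the columns of \<open>G\<close> in such a basis of its range form a Parseval
  frame with Gramian \<open>G\<close>, and \<open>\<rho> g = \<Sum>\<^sub>j f (g j) (f j)\<^sup>T\<close> is the required representation.\<close>

section \<open>Symmetric bilinear forms over the field with two elements\<close>

text \<open>These rules rewrite the field operations to bitwise ones, which hides the ring structure.\<close>

declare add_bit_eq_xor [simp del] mult_bit_eq_and [simp del]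

lemma bit_add_self [simp]: "(x::bit) + x = 0"
  by (cases x) simp_all

lemma bit_mult_self [simp]: "(x::bit) * x = x"
  by (cases x) simp_all

text \<open>Gram-Schmidt by induction on \<open>card V\<close>: split off \<open>v\<close> with
  \<open>B v v = 1\<close> and continue in its orthogonal complement. The last hypothesis excludes
  nonzero alternating forms, so \<open>v\<close> must be chosen such that the complement satisfies
  it again. The expansion of \<open>B x y\<close> expresses that the system is a basis modulo the
  radical, without speaking of spans or dimensions.\<close>

lemma orthonormal_system_exists:
  fixes V :: "'v::plus set" and B :: "'v \<Rightarrow> 'v \<Rightarrow> bit"
  assumes "finite V"
    and "\<And>x y. x \<in> V \<Longrightarrow> y \<in> V \<Longrightarrow> x + y \<in> V"
    and "\<And>x y. x \<in> V \<Longrightarrow> y \<in> V \<Longrightarrow> B x y = B y x"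
    and "\<And>x y z. x \<in> V \<Longrightarrow> y \<in> V \<Longrightarrow> z \<in> V \<Longrightarrow> B (x + y) z = B x z + B y z"
    and "(\<exists>v\<in>V. B v v = 1) \<or> (\<forall>x\<in>V. \<forall>y\<in>V. B x y = 0)"
  shows "\<exists>n u. (\<forall>i<n. u i \<in> V) \<and> (\<forall>i<n. \<forall>k<n. B (u i) (u k) = of_bool (i = k)) \<and>
    (\<forall>x\<in>V. \<forall>y\<in>V. B x y = (\<Sum>i<n::nat. B x (u i) * B y (u i)))"
  using assms
proof (induction "card V" arbitrary: V rule: less_induct)
  case less
  note add = less.prems(2) and sym = less.prems(3) and bil = less.prems(4)
  have bil': "B z (x + y) = B z x + B z y" if "x \<in> V" "y \<in> V" "z \<in> V" for x y z
    using that by (metis add bil sym)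
  let ?W = "\<lambda>v. {x\<in>V. B x v = 0}"
  show ?case
  proof (cases "\<exists>v\<in>V. B v v = 1")
    case False
    then have "\<forall>x\<in>V. \<forall>y\<in>V. B x y = 0" using less.prems(5) by blast
    then show ?thesis by (intro exI[of _ 0]) simp
  next
    case True
    then obtain v0 where v0: "v0 \<in> V" "B v0 v0 = 1" by blast
    obtain v where v: "v \<in> V" "B v v = 1"
      and W: "(\<exists>w\<in>?W v. B w w = 1) \<or> (\<forall>x\<in>?W v. \<forall>y\<in>?W v. B x y = 0)"
    proof (cases "(\<exists>w\<in>?W v0. B w w = 1) \<or> (\<forall>x\<in>?W v0. \<forall>y\<in>?W v0. B x y = 0)")
      case True
      then show ?thesis using that v0 by blast
    next
      txt \<open>If the complement of \<open>v0\<close> is alternating, it contains a hyperbolic pair \<open>a\<close>, \<open>b\<close>; then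
        \<open>v0 + a\<close> has norm 1 and its complement contains \<open>v0 + b\<close>, which has norm 1 as well.\<close>
      case False
      then obtain a b where "a \<in> ?W v0" "b \<in> ?W v0" "B a b \<noteq> 0" by blast
      then have ab: "a \<in> V" "b \<in> V" "B a v0 = 0" "B b v0 = 0" "B a b = 1" by auto
      have alt: "\<forall>w\<in>?W v0. B w w = 0" using False by auto
      have "B v0 a = 0" "B v0 b = 0" "B b a = 1" "B a a = 0" "B b b = 0"
        using ab alt sym[of a v0] sym[of b v0] sym[of a b] v0 by auto
      then have "B (v0 + a) (v0 + a) = 1" "B (v0 + b) (v0 + b) = 1" "B (v0 + b) (v0 + a) = 0"
        using ab v0 by (simp_all add: add bil bil')
      then show ?thesis using that[of "v0 + a"] ab v0 add by blast
    qed
    have "?W v \<subset> V" using v by force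
    then have "card (?W v) < card V" using less.prems(1) by (simp add: psubset_card_mono)
    then have "\<exists>n u. (\<forall>i<n. u i \<in> ?W v) \<and>
        (\<forall>i<n. \<forall>k<n. B (u i) (u k) = of_bool (i = k)) \<and>
        (\<forall>x\<in>?W v. \<forall>y\<in>?W v. B x y = (\<Sum>i<n::nat. B x (u i) * B y (u i)))"
      by (rule less.hyps) (use less.prems(1) add sym bil v W in auto)
    then obtain n and u :: "nat \<Rightarrow> 'v" where u: "\<And>i. i < n \<Longrightarrow> u i \<in> ?W v"
      and orth: "\<And>i k. i < n \<Longrightarrow> k < n \<Longrightarrow> B (u i) (u k) = of_bool (i = k)"
      and exp: "\<And>x y. x \<in> ?W v \<Longrightarrow> y \<in> ?W v \<Longrightarrow> B x y = (\<Sum>i<n. B x (u i) * B y (u i))"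
      by blast
    define u' where "u' = u(n := v)"
    have u'_less: "u' i = u i" if "i < n" for i using that by (simp add: u'_def)
    have u'_n: "u' n = v" by (simp add: u'_def)
    have v_u: "B v (u i) = 0" if "i < n" for i using u[OF that] v sym by auto
    then have "B (u' i) (u' k) = of_bool (i = k)" if "i < Suc n" "k < Suc n" for i k
      using that u orth v by (auto simp: less_Suc_eq u'_less u'_n)
    moreover have "u' i \<in> V" if "i < Suc n" for i
      using that u v by (auto simp: less_Suc_eq u'_less u'_n)
    moreover have "B x y = (\<Sum>i<Suc n. B x (u' i) * B y (u' i))" if x: "x \<in> V" and y: "y \<in> V" for x y
    proof -
      \<comment> \<open>Orthogonal projection onto the complement of \<open>v\<close>, that is,
        \<open>x\<close> plus \<open>B x v\<close> times \<open>v\<close>. The case distinction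
        replaces the scalar multiple, since \<open>'v\<close> carries only an addition.\<close>
      define p where "p x = (if B x v = 0 then x else x + v)" for x
      have p: "p x \<in> ?W v" if "x \<in> V" for x
        using that v by (auto simp: p_def add bil)
      have p_u: "B (p x) (u i) = B x (u i)" if "x \<in> V" "i < n" for x i
        using that u[of i] v v_u by (auto simp: p_def bil)
      have "B x y = B (p x) (p y) + B x v * B y v"
        using x y v sym[of v y] by (auto simp: p_def add bil bil')
      also have "B (p x) (p y) = (\<Sum>i<n. B x (u i) * B y (u i))"
        using exp[OF p p] x y by (simp add: p_u)
      finally show ?thesis by (simp add: u'_less u'_n)
    qed
    ultimately show ?thesis by blast
  qed
qed

section \<open>Parseval frames and their Gramians\<close>

text \<open>With the \<open>f j\<close> as columns of a matrix \<open>F\<close>, both sides say that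
  \<open>F\<close> times its transpose is the identity. Testing on unit vectors gives one direction,
  expanding in coordinates the other.\<close>

lemma binary_parseval_frame_iff:
  "binary_parseval_frame n J f \<longleftrightarrow> finite J \<and> f \<in> J \<rightarrow> carrier_vec n \<and>
    (\<forall>i<n. \<forall>k<n. (\<Sum>j\<in>J. f j $ i * f j $ k) = of_bool (i = k))"
proof (cases "finite J \<and> f \<in> J \<rightarrow> carrier_vec n")
  case True
  then have fin: "finite J" and f: "\<And>j. j \<in> J \<Longrightarrow> f j \<in> carrier_vec n" by auto
  let ?S = "\<lambda>x. finsum_vec TYPE(bit) n (\<lambda>j. (x \<bullet> f j) \<cdot>\<^sub>v f j) J"
  have S: "?S x \<in> carrier_vec n" for x
    using f by (intro finsum_vec_closed) auto
  have S_index: "?S x $ i = (\<Sum>j\<in>J. (x \<bullet> f j) * f j $ i)" if "i < n" for x i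
    using that fin f by (subst index_finsum_vec) (auto simp: carrier_vecD[OF f] intro!: sum.cong)
  have "(\<forall>x\<in>carrier_vec n. x = ?S x) \<longleftrightarrow>
    (\<forall>i<n. \<forall>k<n. (\<Sum>j\<in>J. f j $ i * f j $ k) = of_bool (i = k))"
  proof (intro iffI allI impI ballI)
    fix i k assume *: "\<forall>x\<in>carrier_vec n. x = ?S x" and ik: "i < n" "k < n"
    have "(\<Sum>j\<in>J. f j $ i * f j $ k) = ?S (unit_vec n i) $ k"
      unfolding S_index[OF ik(2)] using ik f by (intro sum.cong) auto
    also have "\<dots> = unit_vec n i $ k" using * by (metis unit_vec_carrier)
    finally show "(\<Sum>j\<in>J. f j $ i * f j $ k) = of_bool (i = k)"
      using ik by auto
  next
    fix x :: "bit vec"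
    assume *: "\<forall>i<n. \<forall>k<n. (\<Sum>j\<in>J. f j $ i * f j $ k) = of_bool (i = k)"
      and x: "x \<in> carrier_vec n"
    show "x = ?S x"
    proof (rule eq_vecI)
      show "dim_vec x = dim_vec (?S x)" using S[of x] x by auto
      fix i assume "i < dim_vec (?S x)"
      then have i: "i < n" using S[of x] by auto
      have "?S x $ i = (\<Sum>j\<in>J. \<Sum>k<n. x $ k * (f j $ k * f j $ i))"
        unfolding S_index[OF i]
        by (simp add: scalar_prod_def lessThan_atLeast0 sum_distrib_right mult.assoc carrier_vecD[OF f])
      also have "\<dots> = (\<Sum>k<n. x $ k * (\<Sum>j\<in>J. f j $ k * f j $ i))"
        by (subst sum.swap) (simp add: sum_distrib_left)
      also have "\<dots> = (\<Sum>k<n. x $ k * of_bool (k = i))"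
        using * i by (intro sum.cong) auto
      also have "\<dots> = x $ i" using i by (simp add: of_bool_def if_distrib[where f = "(*) c" for c] cong: if_cong)
      finally show "x $ i = ?S x $ i" by simp
    qed
  qed
  then show ?thesis using True by (simp add: binary_parseval_frame_def)
qed (auto simp: binary_parseval_frame_def)

text \<open>Polarised Parseval identity. For frame vectors \<open>x\<close> and \<open>y\<close> it
  says that the Gramian is idempotent.\<close>

lemma binary_parseval_frame_scalar_prod:
  assumes "binary_parseval_frame n J f" and x: "x \<in> carrier_vec n" and y: "y \<in> carrier_vec n"
  shows "(\<Sum>j\<in>J. (x \<bullet> f j) * (f j \<bullet> y)) = x \<bullet> y"
proof -
  from assms(1) have f: "\<And>j. j \<in> J \<Longrightarrow> f j \<in> carrier_vec n"
    and *: "\<And>i k. i < n \<Longrightarrow> k < n \<Longrightarrow> (\<Sum>j\<in>J. f j $ i * f j $ k) = of_bool (i = k)"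
    by (auto simp: binary_parseval_frame_iff)
  have "(\<Sum>j\<in>J. (x \<bullet> f j) * (f j \<bullet> y)) =
      (\<Sum>j\<in>J. (\<Sum>i<n. x $ i * f j $ i) * (\<Sum>k<n. f j $ k * y $ k))"
    using y by (simp add: scalar_prod_def lessThan_atLeast0 carrier_vecD[OF f])
  also have "\<dots> = (\<Sum>j\<in>J. \<Sum>i<n. \<Sum>k<n. x $ i * y $ k * (f j $ i * f j $ k))"
    unfolding sum_product by (intro sum.cong refl) (simp only: mult_ac)
  also have "\<dots> = (\<Sum>i<n. \<Sum>k<n. x $ i * y $ k * (\<Sum>j\<in>J. f j $ i * f j $ k))"
    by (subst sum.swap, subst sum.swap) (simp add: sum_distrib_left)
  also have "\<dots> = (\<Sum>i<n. \<Sum>k<n. x $ i * y $ k * of_bool (i = k))"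
    using * by (intro sum.cong) auto
  also have "\<dots> = x \<bullet> y"
    using y by (simp add: scalar_prod_def of_bool_def lessThan_atLeast0 if_distrib[where f = "(*) c" for c]
        cong: if_cong)
  finally show ?thesis .
qed

lemma symmetric_idempotent_is_gramian:
  fixes P :: "'a \<Rightarrow> 'a \<Rightarrow> bit"
  assumes fin: "finite J"
    and sym: "\<And>a b. a \<in> J \<Longrightarrow> b \<in> J \<Longrightarrow> P a b = P b a"
    and idem: "\<And>a c. a \<in> J \<Longrightarrow> c \<in> J \<Longrightarrow> (\<Sum>b\<in>J. P a b * P b c) = P a c"
    and diag: "\<exists>a\<in>J. P a a = 1"
  shows "\<exists>n f. binary_parseval_frame n J f \<and> (\<forall>a\<in>J. \<forall>b\<in>J. f a \<bullet> f b = P a b)"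
proof -
  \<comment> \<open>The range of the idempotent \<open>P\<close>, described as its fixed space.
    Vanishing outside the finite set \<open>J\<close> makes it finite.\<close>
  define V where "V = {x. (\<forall>a. a \<notin> J \<longrightarrow> x a = 0) \<and> (\<forall>a\<in>J. (\<Sum>b\<in>J. P a b * x b) = x a)}"
  define B where "B x y = (\<Sum>a\<in>J. x a * y a)" for x y :: "'a \<Rightarrow> bit"
  define c where "c b = (\<lambda>a. if a \<in> J then P a b else 0)" for b
  have c: "c b \<in> V" if "b \<in> J" for b
    using that idem by (auto simp: V_def c_def cong: sum.cong)
  \<comment> \<open>Pairing with column \<open>b\<close> of \<open>P\<close> evaluates at
    \<open>b\<close>: by symmetry of \<open>P\<close> the pairing is entry \<open>b\<close> of
    \<open>P\<close> applied to \<open>x\<close>, and \<open>P\<close> fixes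
    \<open>x\<close>.\<close>
  have B_c: "B x (c b) = x b" "B (c b) x = x b" if "x \<in> V" "b \<in> J" for x b
    using that sym by (auto simp: V_def B_def c_def mult.commute cong: sum.cong)
  have "finite V"
  proof (rule finite_subset)
    show "V \<subseteq> {x. \<forall>a. (a \<in> J \<longrightarrow> x a \<in> {0, 1}) \<and> (a \<notin> J \<longrightarrow> x a = 0)}"
      by (auto simp: V_def)
  qed (use fin in \<open>intro finite_set_of_finite_funs, auto\<close>)
  moreover have "x + y \<in> V" if "x \<in> V" "y \<in> V" for x y
    using that by (simp add: V_def distrib_left sum.distrib)
  moreover have "B x y = B y x" for x y
    by (simp add: B_def mult.commute)
  moreover have "B (x + y) z = B x z + B y z" for x y z
    by (simp add: B_def distrib_right sum.distrib)
  moreover from diag obtain a where "a \<in> J" "P a a = 1" by blast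
  then have "c a \<in> V" "B (c a) (c a) = 1" by (simp_all add: c B_c) (simp add: c_def)
  ultimately have "\<exists>n u. (\<forall>i<n. u i \<in> V) \<and> (\<forall>i<n. \<forall>k<n. B (u i) (u k) = of_bool (i = k)) \<and>
      (\<forall>x\<in>V. \<forall>y\<in>V. B x y = (\<Sum>i<n::nat. B x (u i) * B y (u i)))"
    by (intro orthonormal_system_exists) blast+
  then obtain n and u :: "nat \<Rightarrow> 'a \<Rightarrow> bit" where u: "\<And>i. i < n \<Longrightarrow> u i \<in> V"
    and orth: "\<And>i k. i < n \<Longrightarrow> k < n \<Longrightarrow> B (u i) (u k) = of_bool (i = k)"
    and exp: "\<And>x y. x \<in> V \<Longrightarrow> y \<in> V \<Longrightarrow> B x y = (\<Sum>i<n. B x (u i) * B y (u i))"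
    by blast
  \<comment> \<open>For \<open>a\<close> in \<open>J\<close>, \<open>u i a\<close> equals
    \<open>B (c a) (u i)\<close>, so \<open>f a\<close> lists the coordinates of the column
    \<open>c a\<close>. The matrix with columns \<open>f a\<close> has the orthonormal
    \<open>u i\<close> as rows, which is the Parseval property.\<close>
  define f where "f a = vec n (\<lambda>i. u i a)" for a
  have "binary_parseval_frame n J f"
    using fin orth by (auto simp: binary_parseval_frame_iff f_def B_def)
  moreover have "f a \<bullet> f b = P a b" if "a \<in> J" "b \<in> J" for a b
  proof -
    have "f a \<bullet> f b = (\<Sum>i<n. B (c a) (u i) * B (c b) (u i))"
      using that u by (auto simp: f_def scalar_prod_def lessThan_atLeast0 B_c intro!: sum.cong)
    also have "\<dots> = B (c a) (c b)" using exp that c by simp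
    also have "\<dots> = c a b" using that c B_c by blast
    also have "\<dots> = P a b" using that sym by (simp add: c_def)
    finally show ?thesis .
  qed
  ultimately show ?thesis by blast
qed

section \<open>Group frames\<close>

context group
begin

text \<open>The substitution \<open>b = a \<otimes> g\<close> reveals the matrix entries of the
  operator.\<close>

lemma right_regular_sum_eq:
  assumes "\<phi> \<in> bit_functions G" and a: "a \<in> carrier G"
  shows "right_regular_sum G \<eta> \<phi> a = (\<Sum>b\<in>carrier G. \<eta> (inv a \<otimes> b) * \<phi> b)"
proof -
  have "right_regular_sum G \<eta> \<phi> a = (\<Sum>g\<in>carrier G. \<eta> g * \<phi> (a \<otimes> g))"
    using assms by (simp add: right_regular_sum_def right_regular_def)
  also have "\<dots> = (\<Sum>b\<in>carrier G. \<eta> (inv a \<otimes> b) * \<phi> b)"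
    using a by (intro sum.reindex_bij_witness[of _ "\<lambda>b. inv a \<otimes> b" "\<lambda>g. a \<otimes> g"])
      (auto simp flip: m_assoc)
  finally show ?thesis .
qed

lemma right_regular_sum_eq_gramian_iff:
  assumes fin: "finite (carrier G)"
  shows "right_regular_sum G \<eta> = gramian G f \<longleftrightarrow>
    (\<forall>a\<in>carrier G. \<forall>b\<in>carrier G. f b \<bullet> f a = \<eta> (inv a \<otimes> b))"
proof (intro iffI ballI)
  fix a b assume eq: "right_regular_sum G \<eta> = gramian G f" and ab: "a \<in> carrier G" "b \<in> carrier G"
  \<comment> \<open>The standard basis vector at \<open>b\<close>, which extracts column
    \<open>b\<close> of both operators.\<close>
  define \<delta> where "\<delta> = (\<lambda>x\<in>carrier G. of_bool (x = b) :: bit)"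
  have \<delta>: "\<delta> \<in> bit_functions G" by (simp add: \<delta>_def bit_functions_def)
  have sum_\<delta>: "(\<Sum>x\<in>carrier G. F x * \<delta> x) = F b" for F
    using fin ab(2) by (simp add: \<delta>_def of_bool_def if_distrib[where f = "(*) c" for c] cong: sum.cong if_cong)
  have "gramian G f \<delta> a = f b \<bullet> f a"
    using ab(1) \<delta> sum_\<delta>[of "\<lambda>x. f x \<bullet> f a"] by (simp add: gramian_def)
  moreover have "right_regular_sum G \<eta> \<delta> a = \<eta> (inv a \<otimes> b)"
    using right_regular_sum_eq[OF \<delta> ab(1)] sum_\<delta> by simp
  ultimately show "f b \<bullet> f a = \<eta> (inv a \<otimes> b)" using eq by simp
next
  assume *: "\<forall>a\<in>carrier G. \<forall>b\<in>carrier G. f b \<bullet> f a = \<eta> (inv a \<otimes> b)"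
  show "right_regular_sum G \<eta> = gramian G f"
  proof (intro ext)
    fix \<phi> a
    show "right_regular_sum G \<eta> \<phi> a = gramian G f \<phi> a"
    proof (cases "\<phi> \<in> bit_functions G \<and> a \<in> carrier G")
      case True
      then show ?thesis using * by (simp add: right_regular_sum_eq) (simp add: gramian_def)
    next
      case False
      then show ?thesis by (auto simp: right_regular_sum_def gramian_def)
    qed
  qed
qed

text \<open>The Gramian depends on \<open>inv a \<otimes> b\<close> only, so left translation
  preserves scalar products of frame vectors. Hence the operator \<open>\<rho> g\<close>, which
  analyses with \<open>f j\<close> and synthesises with \<open>f (g \<otimes> j)\<close>, maps
  \<open>f h\<close> to \<open>f (g \<otimes> h)\<close>; multiplicativity follows from
  this.\<close>

lemma binary_parseval_group_frameI:
  assumes frame: "binary_parseval_frame n (carrier G) f"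
    and gram: "\<And>a b. a \<in> carrier G \<Longrightarrow> b \<in> carrier G \<Longrightarrow> f b \<bullet> f a = \<eta> (inv a \<otimes> b)"
  shows "binary_parseval_group_frame G n f"
proof -
  from frame have f: "\<And>j. j \<in> carrier G \<Longrightarrow> f j \<in> carrier_vec n"
    and pars: "\<And>i k. i < n \<Longrightarrow> k < n \<Longrightarrow> (\<Sum>j\<in>carrier G. f j $ i * f j $ k) = of_bool (i = k)"
    by (auto simp: binary_parseval_frame_iff)
  define \<rho> where "\<rho> g = mat n n (\<lambda>(i, k). \<Sum>j\<in>carrier G. f (g \<otimes> j) $ i * f j $ k)" for g
  have \<rho>_carrier: "\<rho> g \<in> carrier_mat n n" for g by (simp add: \<rho>_def)
  have translate: "(\<Sum>j\<in>carrier G. f (g \<otimes> j) $ i * (f j \<bullet> f h)) = f (g \<otimes> h) $ i"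
    if g: "g \<in> carrier G" and h: "h \<in> carrier G" and i: "i < n" for g h i
  proof -
    have "f j \<bullet> f h = f (g \<otimes> j) \<bullet> f (g \<otimes> h)" if "j \<in> carrier G" for j
      using that g h by (simp add: gram inv_mult_group m_assoc) (simp add: inv_solve_left' flip: m_assoc)
    then have "(\<Sum>j\<in>carrier G. f (g \<otimes> j) $ i * (f j \<bullet> f h)) =
        (\<Sum>j\<in>carrier G. f (g \<otimes> j) $ i * (f (g \<otimes> j) \<bullet> f (g \<otimes> h)))" by simp
    also have "\<dots> = (\<Sum>j\<in>carrier G. f j $ i * (f j \<bullet> f (g \<otimes> h)))"
      using g by (intro sum.reindex_bij_witness[of _ "\<lambda>j. inv g \<otimes> j" "\<lambda>j. g \<otimes> j"])
        (auto simp flip: m_assoc)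
    \<comment> \<open>Writing entry \<open>i\<close> as a scalar product with a unit vector makes
      the polarised Parseval identity applicable.\<close>
    also have "\<dots> = (\<Sum>j\<in>carrier G. (unit_vec n i \<bullet> f j) * (f j \<bullet> f (g \<otimes> h)))"
      using f i by (intro sum.cong) auto
    also have "\<dots> = unit_vec n i \<bullet> f (g \<otimes> h)"
      using frame f g h by (intro binary_parseval_frame_scalar_prod) auto
    finally show ?thesis using f g h i by simp
  qed
  have \<rho>_f: "\<rho> g *\<^sub>v f h = f (g \<otimes> h)" if g: "g \<in> carrier G" and h: "h \<in> carrier G" for g h
  proof (rule eq_vecI)
    show "dim_vec (\<rho> g *\<^sub>v f h) = dim_vec (f (g \<otimes> h))"
      using f[of "g \<otimes> h"] g h by (simp add: \<rho>_def)
    fix i assume "i < dim_vec (f (g \<otimes> h))"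
    then have i: "i < n" using f[of "g \<otimes> h"] g h by simp
    have "(\<rho> g *\<^sub>v f h) $ i = (\<Sum>k<n. \<Sum>j\<in>carrier G. f (g \<otimes> j) $ i * (f j $ k * f h $ k))"
      using i f[OF h] by (auto simp: \<rho>_def scalar_prod_def lessThan_atLeast0 sum_distrib_right mult.assoc)
    also have "\<dots> = (\<Sum>j\<in>carrier G. f (g \<otimes> j) $ i * (f j \<bullet> f h))"
      using f[OF h] by (subst sum.swap) (simp add: scalar_prod_def lessThan_atLeast0 sum_distrib_left)
    finally show "(\<rho> g *\<^sub>v f h) $ i = f (g \<otimes> h) $ i"
      using translate g h i by simp
  qed
  \<comment> \<open>This is exactly the coordinate form of the Parseval property.\<close>
  have \<rho>_one: "\<rho> \<one> = 1\<^sub>m n"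
    using pars by (intro eq_matI) (auto simp: \<rho>_def)
  have \<rho>_mult: "\<rho> (g \<otimes> h) = \<rho> g * \<rho> h" if g: "g \<in> carrier G" and h: "h \<in> carrier G" for g h
  proof (rule eq_matI)
    fix i k assume "i < dim_row (\<rho> g * \<rho> h)" "k < dim_col (\<rho> g * \<rho> h)"
    then have i: "i < n" and k: "k < n" by (simp_all add: \<rho>_def)
    have "(\<rho> g * \<rho> h) $$ (i, k) =
        (\<Sum>l<n. \<Sum>j\<in>carrier G. \<rho> g $$ (i, l) * f (h \<otimes> j) $ l * f j $ k)"
      using i k by (auto simp: scalar_prod_def lessThan_atLeast0 sum_distrib_left mult.assoc \<rho>_def[of h]
          \<rho>_carrier carrier_matD[OF \<rho>_carrier])
    also have "\<dots> = (\<Sum>j\<in>carrier G. (\<rho> g *\<^sub>v f (h \<otimes> j)) $ i * f j $ k)"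
      using i h carrier_matD[OF \<rho>_carrier[of g]]
      by (subst sum.swap) (simp add: scalar_prod_def lessThan_atLeast0 sum_distrib_right carrier_vecD[OF f])
    also have "\<dots> = \<rho> (g \<otimes> h) $$ (i, k)"
      using g h i k by (simp add: \<rho>_f m_assoc) (simp add: \<rho>_def m_assoc)
    finally show "\<rho> (g \<otimes> h) $$ (i, k) = (\<rho> g * \<rho> h) $$ (i, k)" by simp
  qed (simp_all add: \<rho>_def)
  have "\<rho> g \<in> Units (ring_mat TYPE(bit) n ())" if g: "g \<in> carrier G" for g
  proof -
    have "\<rho> (inv g) * \<rho> g = 1\<^sub>m n" "\<rho> g * \<rho> (inv g) = 1\<^sub>m n"
      using g \<rho>_mult[of "inv g" g] \<rho>_mult[of g "inv g"] \<rho>_one by simp_all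
    then show ?thesis
      using \<rho>_carrier[of g] \<rho>_carrier[of "inv g"] by (auto simp: Units_def ring_mat_simps)
  qed
  then have "\<rho> \<in> hom G (general_linear n)"
    using \<rho>_mult by (intro homI) (simp_all add: general_linear_def units_of_carrier units_of_mult ring_mat_simps)
  moreover have "\<forall>g\<in>carrier G. f g = \<rho> g *\<^sub>v f \<one>" by (simp add: \<rho>_f)
  ultimately show ?thesis using frame unfolding binary_parseval_group_frame_def by blast
qed

end

text \<open>Squaring is the identity on bits, so \<open>x \<bullet> x\<close> is the scalar product
  with the all-ones vector \<open>s\<close>. If every \<open>f j\<close> were isotropic, all would
  be orthogonal to \<open>s\<close>, and the Parseval identity would make the first unit vector
  orthogonal to \<open>s\<close> too.\<close>

lemma binary_parseval_frame_not_all_isotropic: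
  assumes frame: "binary_parseval_frame n J f" and n: "0 < n"
  shows "\<exists>j\<in>J. f j \<bullet> f j = 1"
proof (rule ccontr)
  assume "\<not> ?thesis"
  then have iso: "f j \<bullet> f j = 0" if "j \<in> J" for j using that by auto
  from frame have f: "f j \<in> carrier_vec n" if "j \<in> J" for j
    using that by (auto simp: binary_parseval_frame_iff)
  define s :: "bit vec" where "s = vec n (\<lambda>_. 1)"
  have s: "s \<in> carrier_vec n" by (simp add: s_def)
  have self: "x \<bullet> s = x \<bullet> x" if "x \<in> carrier_vec n" for x
    using that by (auto simp: s_def scalar_prod_def)
  let ?x = "unit_vec n 0 :: bit vec"
  have "?x \<bullet> s = (\<Sum>j\<in>J. (?x \<bullet> f j) * (f j \<bullet> s))"
    using binary_parseval_frame_scalar_prod[OF frame _ s, of ?x] by simp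
  also have "\<dots> = 0" using f iso by (intro sum.neutral) (simp add: self)
  finally show False using n by (simp add: s_def)
qed

theorem theorem3p8:
  fixes \<Gamma> :: "('a, 'm) monoid_scheme" and \<eta> :: "'a \<Rightarrow> bit"
  assumes "group \<Gamma>" and "finite (carrier \<Gamma>)"
  shows "is_gramian_of_binary_parseval_group_frame \<Gamma> (right_regular_sum \<Gamma> \<eta>) \<longleftrightarrow>
    \<eta> \<one>\<^bsub>\<Gamma>\<^esub> = 1 \<and>
    (\<forall>g\<in>carrier \<Gamma>. \<eta> g = \<eta> (inv\<^bsub>\<Gamma>\<^esub> g)) \<and>
    (\<forall>h\<in>carrier \<Gamma>. \<eta> h = convolution \<Gamma> \<eta> \<eta> h)"
proof -
  interpret group \<Gamma> by (rule assms(1))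
  show ?thesis
  proof (intro iffI)
    assume "is_gramian_of_binary_parseval_group_frame \<Gamma> (right_regular_sum \<Gamma> \<eta>)"
    then obtain n f where n: "0 < n" and frame: "binary_parseval_frame n (carrier \<Gamma>) f"
      and "right_regular_sum \<Gamma> \<eta> = gramian \<Gamma> f"
      by (auto simp: is_gramian_of_binary_parseval_group_frame_def binary_parseval_group_frame_def)
    then have gram: "f b \<bullet> f a = \<eta> (inv\<^bsub>\<Gamma>\<^esub> a \<otimes>\<^bsub>\<Gamma>\<^esub> b)" if "a \<in> carrier \<Gamma>" "b \<in> carrier \<Gamma>" for a b
      using that right_regular_sum_eq_gramian_iff[OF assms(2)] by blast
    from frame have f: "f j \<in> carrier_vec n" if "j \<in> carrier \<Gamma>" for j
      using that by (auto simp: binary_parseval_frame_iff)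
    \<comment> \<open>Every diagonal entry of the Gramian equals \<open>\<eta>\<close> at the
      identity, and one of them is 1.\<close>
    have "\<eta> \<one>\<^bsub>\<Gamma>\<^esub> = 1"
      using binary_parseval_frame_not_all_isotropic[OF frame n] by (auto simp: gram)
    moreover have "\<eta> g = \<eta> (inv\<^bsub>\<Gamma>\<^esub> g)" if "g \<in> carrier \<Gamma>" for g
      using that gram[of "\<one>\<^bsub>\<Gamma>\<^esub>" g] gram[of g "\<one>\<^bsub>\<Gamma>\<^esub>"]
        comm_scalar_prod[OF f[of g] f[of "\<one>\<^bsub>\<Gamma>\<^esub>"]] by simp
    moreover have "\<eta> h = convolution \<Gamma> \<eta> \<eta> h" if h: "h \<in> carrier \<Gamma>" for h
    proof -
      have "\<eta> h = f h \<bullet> f \<one>\<^bsub>\<Gamma>\<^esub>" using h by (simp add: gram)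
      also have "\<dots> = (\<Sum>j\<in>carrier \<Gamma>. (f h \<bullet> f j) * (f j \<bullet> f \<one>\<^bsub>\<Gamma>\<^esub>))"
        using frame f h by (intro binary_parseval_frame_scalar_prod[symmetric]) auto
      \<comment> \<open>The factors are \<open>\<eta> (inv j \<otimes> h)\<close> and
        \<open>\<eta> j\<close>, so the summation index \<open>j\<close> is already that of the
        convolution.\<close>
      also have "\<dots> = convolution \<Gamma> \<eta> \<eta> h"
        using h by (auto simp: convolution_def gram mult.commute intro!: sum.cong)
      finally show ?thesis .
    qed
    ultimately show "\<eta> \<one>\<^bsub>\<Gamma>\<^esub> = 1 \<and> (\<forall>g\<in>carrier \<Gamma>. \<eta> g = \<eta> (inv\<^bsub>\<Gamma>\<^esub> g)) \<and>
      (\<forall>h\<in>carrier \<Gamma>. \<eta> h = convolution \<Gamma> \<eta> \<eta> h)" by blast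
  next
    assume \<eta>: "\<eta> \<one>\<^bsub>\<Gamma>\<^esub> = 1 \<and> (\<forall>g\<in>carrier \<Gamma>. \<eta> g = \<eta> (inv\<^bsub>\<Gamma>\<^esub> g)) \<and>
      (\<forall>h\<in>carrier \<Gamma>. \<eta> h = convolution \<Gamma> \<eta> \<eta> h)"
    define P where "P a b = \<eta> (inv\<^bsub>\<Gamma>\<^esub> a \<otimes>\<^bsub>\<Gamma>\<^esub> b)" for a b
    have sym: "P a b = P b a" if "a \<in> carrier \<Gamma>" "b \<in> carrier \<Gamma>" for a b
    proof -
      have "P a b = \<eta> (inv\<^bsub>\<Gamma>\<^esub> (inv\<^bsub>\<Gamma>\<^esub> a \<otimes>\<^bsub>\<Gamma>\<^esub> b))"
        unfolding P_def using that \<eta> by blast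
      then show ?thesis using that by (simp add: P_def inv_mult_group)
    qed
    have idem: "(\<Sum>b\<in>carrier \<Gamma>. P a b * P b c) = P a c"
      if a: "a \<in> carrier \<Gamma>" and c: "c \<in> carrier \<Gamma>" for a c
    proof -
      \<comment> \<open>Substitute \<open>g = inv a \<otimes> b\<close>; then
        \<open>inv b \<otimes> c\<close> becomes
        \<open>inv g \<otimes> (inv a \<otimes> c)\<close>.\<close>
      have "(\<Sum>b\<in>carrier \<Gamma>. P a b * P b c) = convolution \<Gamma> \<eta> \<eta> (inv\<^bsub>\<Gamma>\<^esub> a \<otimes>\<^bsub>\<Gamma>\<^esub> c)"
        unfolding convolution_def P_def using a c
        by (intro sum.reindex_bij_witness[of _ "\<lambda>g. a \<otimes>\<^bsub>\<Gamma>\<^esub> g" "\<lambda>b. inv\<^bsub>\<Gamma>\<^esub> a \<otimes>\<^bsub>\<Gamma>\<^esub> b"])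
          (auto simp: inv_mult_group simp flip: m_assoc, simp add: m_assoc)
      also have "\<dots> = P a c" unfolding P_def using a c \<eta> by (metis inv_closed m_closed)
      finally show ?thesis .
    qed
    have "\<exists>a\<in>carrier \<Gamma>. P a a = 1"
      using conjunct1[OF \<eta>] by (intro bexI[of _ "\<one>\<^bsub>\<Gamma>\<^esub>"]) (simp_all add: P_def)
    from symmetric_idempotent_is_gramian[of _ P, OF assms(2) sym idem this]
    obtain n f where frame: "binary_parseval_frame n (carrier \<Gamma>) f"
      and fP: "\<And>a b. a \<in> carrier \<Gamma> \<Longrightarrow> b \<in> carrier \<Gamma> \<Longrightarrow> f a \<bullet> f b = P a b" by blast
    then have gram: "f b \<bullet> f a = \<eta> (inv\<^bsub>\<Gamma>\<^esub> a \<otimes>\<^bsub>\<Gamma>\<^esub> b)" if "a \<in> carrier \<Gamma>" "b \<in> carrier \<Gamma>" for a b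
      using that sym[of a b] by (simp add: P_def)
    \<comment> \<open>In dimension 0 all scalar products vanish, but the diagonal of this Gramian is
      1.\<close>
    have "n \<noteq> 0"
    proof
      assume "n = 0"
      then have "f \<one>\<^bsub>\<Gamma>\<^esub> \<in> carrier_vec 0"
        using frame by (auto simp: binary_parseval_frame_iff)
      then have "f \<one>\<^bsub>\<Gamma>\<^esub> \<bullet> f \<one>\<^bsub>\<Gamma>\<^esub> = 0"
        by (simp add: scalar_prod_def)
      then show False using gram[of "\<one>\<^bsub>\<Gamma>\<^esub>" "\<one>\<^bsub>\<Gamma>\<^esub>"] conjunct1[OF \<eta>] by simp
    qed
    moreover have "binary_parseval_group_frame \<Gamma> n f"
      using frame gram by (rule binary_parseval_group_frameI)
    moreover have "right_regular_sum \<Gamma> \<eta> = gramian \<Gamma> f"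
      using gram by (simp add: right_regular_sum_eq_gramian_iff[OF assms(2)])
    ultimately show "is_gramian_of_binary_parseval_group_frame \<Gamma> (right_regular_sum \<Gamma> \<eta>)"
      unfolding is_gramian_of_binary_parseval_group_frame_def by blast
  qed
qed

end
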